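(* (i) Let $F$ be any field, and let $A_1,A_2,A_3$ be finite subsets of $F$ with $|A_1|\ge 2$, $|A_3|\ge 2$ and $|A_2|-|A_1|\in\{0,1\}$. Then $$|L(A_1,A_2,A_3)|\ge\min\{p(F),\ |A_1|+|A_2|+|A_3|-4\}.$$ (ii) Let $G$ be a torsion-free additive abelian group, and let $A_1,A_2,A_3$ be finite subsets of $G$ with $2\le |A_1|\le |A_2|\le |A_3|$. Then $$|L(A_1,A_2,A_3)|\ge |A_1|+|A_2|+|A_3|-4.$$
   Context: For finite subsets $A_1,\dots,A_n$ of an additive abelian group $G$, define $L(A_1,\dots,A_n)=\{a_1+\cdots+a_n:\ a_i\in A_i\ (1\le i\le n),\ a_i\ne a_{i+1}\text{ for all }1\le i<n\}$. For a field $F$, $p(F)$ denotes the characteristic of $F$ if it is a prime $p$, and $p(F)=+\infty$ if $F$ has characteristic $0$. *)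

theory Defs
  imports "HOL-Library.Extended_Nat"
begin

definition L_set :: "'a::ab_group_add set list \<Rightarrow> 'a set" where
  "L_set As = {sum_list as | as. length as = length As \<and>
             (\<forall>i<length As. as ! i \<in> As ! i) \<and>
             (\<forall>i. Suc i < length As \<longrightarrow> as ! i \<noteq> as ! Suc i)}"

text \<open>The library's characteristic \<^term>\<open>CHAR('a::field)\<close> is \<open>0\<close> in characteristic zero,
  where the convention here is \<open>p(F) = +\<infinity>\<close>.\<close>

definition p_char :: "'a::field itself \<Rightarrow> enat" where
  "p_char _ = (if CHAR('a) = 0 then \<infinity> else enat CHAR('a))"

definition torsion_free :: "'g::ab_group_add itself \<Rightarrow> bool" where
  "torsion_free _ \<longleftrightarrow> (\<forall>(n::nat) (x::'g). n > 0 \<longrightarrow> (\<Sum>i<n. x) = 0 \<longrightarrow> x = 0)"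

end

theory Submission
  imports Defs "HOL-Computational_Algebra.Polynomial" "HOL-Computational_Algebra.Primes"
begin

text \<open>
  Write \<open>a, b, c\<close> for the cardinalities of the three sets minus one and put \<open>n = a + b + c - 2\<close>.
  If \<open>L\<close> had at most \<open>n\<close> elements, then \<open>(x - y) (y - z) q (x + y + z)\<close> would vanish on
  \<open>A \<times> B \<times> C\<close> for some monic univariate \<open>q\<close> of degree \<open>n\<close>. By the Combinatorial Nullstellensatz
  this forces the coefficient of \<open>x\<^sup>a y\<^sup>b z\<^sup>c\<close>, which is
  \<open>n! / (a! b! c!) ((a - b) (b - c) + b)\<close>, to be zero. In (i) the last factor is \<open>b\<close> or \<open>c\<close>, and
  shrinking the sets makes \<open>n < p\<close>; if \<open>a \<le> b \<le> c\<close> it is positive, which settles (ii) for subsets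
  of \<open>\<rat>\<close>. A finitely generated torsion-free group has a homomorphism to \<open>\<rat>\<close> that is injective on
  a prescribed finite set, so (ii) reduces to that case.
\<close>

section \<open>Restricted sumsets of three sets\<close>

lemma L_set_3:
  "L_set [A, B, C] = {x + y + z | x y z. x \<in> A \<and> y \<in> B \<and> z \<in> C \<and> x \<noteq> y \<and> y \<noteq> z}"
    (is "_ = ?R")
proof (intro equalityI subsetI)
  fix s assume "s \<in> L_set [A, B, C]"
  then obtain as where as: "s = sum_list as" "length as = 3"
    "\<forall>i<3. as ! i \<in> [A, B, C] ! i" "\<forall>i. Suc i < 3 \<longrightarrow> as ! i \<noteq> as ! Suc i"
    unfolding L_set_def by (auto simp: numeral_3_eq_3)
  from as(2) obtain x y z where xyz: "as = [x, y, z]"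
    by (auto simp: numeral_3_eq_3 length_Suc_conv)
  show "s \<in> ?R"
    using as(1) as(3)[rule_format, of 0] as(3)[rule_format, of 1] as(3)[rule_format, of 2]
      as(4)[rule_format, of 0] as(4)[rule_format, of 1]
    by (auto simp: xyz numeral_2_eq_2 add.assoc)
next
  fix s assume "s \<in> ?R"
  then obtain x y z where "s = x + y + z" "x \<in> A" "y \<in> B" "z \<in> C" "x \<noteq> y" "y \<noteq> z"
    by blast
  then show "s \<in> L_set [A, B, C]"
    unfolding L_set_def
    by (intro CollectI exI[of _ "[x, y, z]"]) (auto simp: less_Suc_eq add.assoc)
qed

lemma finite_L_set_3:
  assumes "finite A" "finite B" "finite C"
  shows "finite (L_set [A, B, C])"
proof (rule finite_subset)
  show "L_set [A, B, C] \<subseteq> (\<lambda>(x, y, z). x + y + z) ` (A \<times> B \<times> C)"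
    by (force simp: L_set_3)
qed (use assms in simp)

lemma L_set_3_mono:
  "A \<subseteq> A' \<Longrightarrow> B \<subseteq> B' \<Longrightarrow> C \<subseteq> C' \<Longrightarrow> L_set [A, B, C] \<subseteq> L_set [A', B', C']"
  unfolding L_set_3 by blast

section \<open>The coefficient functional and the polynomial method\<close>

text \<open>These are the Lagrange weights, \<open>w x\<close> being the inverse of the product of
  \<open>x - y\<close> over the other points \<open>y\<close> of \<open>A\<close>. Summing against
  them extracts the coefficient of degree \<open>card A - 1\<close> from any polynomial of degree
  below \<open>card A\<close>.\<close>

lemma ex_leading_coeff_weights:
  fixes A :: "'a::field set"
  assumes "finite A" "A \<noteq> {}"
  shows "\<exists>w. \<forall>i<card A. (\<Sum>x\<in>A. w x * x ^ i) = (if Suc i = card A then 1 else 0)"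
  using assms
proof (induction rule: finite_ne_induct)
  case (singleton x)
  show ?case by (rule exI[of _ "\<lambda>_. 1"]) simp
next
  case (insert z A)
  then obtain w where w: "\<And>i. i < card A \<Longrightarrow>
    (\<Sum>x\<in>A. w x * x ^ i) = (if Suc i = card A then 1 else 0)" by blast
  \<comment> \<open>A new point \<open>z\<close> divides the old weights by \<open>x - z\<close>;
    the weight at \<open>z\<close> is chosen to make the total vanish. Higher moments then follow
    from \<open>x ^ Suc i = (x - z) * x ^ i + z * x ^ i\<close>.\<close>
  define v where "v x = (if x = z then - (\<Sum>x\<in>A. w x / (x - z)) else w x / (x - z))" for x
  have v_A: "v x * (x - z) = w x" if "x \<in> A" for x
    using that insert.hyps by (auto simp: v_def)
  have sum_v: "(\<Sum>x\<in>A. v x) = (\<Sum>x\<in>A. w x / (x - z))"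
    using insert.hyps by (intro sum.cong) (auto simp: v_def)
  have zero: "(\<Sum>x\<in>insert z A. v x) = 0"
    using insert.hyps by (simp add: sum_v) (simp add: v_def)
  have step: "(\<Sum>x\<in>insert z A. v x * x ^ Suc i) =
      (\<Sum>x\<in>A. w x * x ^ i) + z * (\<Sum>x\<in>insert z A. v x * x ^ i)" for i
  proof -
    have "(\<Sum>x\<in>insert z A. v x * x ^ Suc i) =
        (\<Sum>x\<in>insert z A. v x * (x - z) * x ^ i) + z * (\<Sum>x\<in>insert z A. v x * x ^ i)"
      by (simp only: sum_distrib_left sum.distrib[symmetric])
        (rule sum.cong, auto simp: algebra_simps)
    also have "(\<Sum>x\<in>insert z A. v x * (x - z) * x ^ i) = (\<Sum>x\<in>A. v x * (x - z) * x ^ i)"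
      using insert.hyps by simp
    also have "\<dots> = (\<Sum>x\<in>A. w x * x ^ i)"
      by (rule sum.cong) (simp_all add: v_A)
    finally show ?thesis .
  qed
  have card: "card (insert z A) = Suc (card A)" "card A > 0"
    using insert.hyps by auto
  have "(\<Sum>x\<in>insert z A. v x * x ^ i) = (if Suc i = card (insert z A) then 1 else 0)"
    if "i < card (insert z A)" for i
    using that
  proof (induction i)
    case 0
    then show ?case using zero card by simp
  next
    case (Suc i)
    then have "i < card A" "i < card (insert z A)" using card by auto
    then show ?case unfolding step using w[of i] Suc.IH card by simp
  qed
  then show ?case by blast
qed

lemma card_L_set_3_ge:
  fixes A B C :: "'a::field set" and a b c :: nat
  assumes card: "card A = Suc a" "card B = Suc b" "card C = Suc c"
    and pos: "a > 0" "b > 0" "c > 0"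
    and fact: "of_nat (fact (a + b + c - 2)) \<noteq> (0::'a)"
    and factor: "of_int ((int a - int b) * (int b - int c) + int b) \<noteq> (0::'a)"
  shows "card (L_set [A, B, C]) \<ge> a + b + c - 1"
proof (rule ccontr)
  assume small: "\<not> ?thesis"
  define n where "n = a + b + c - 2"
  have n: "n + 2 = a + b + c" "a \<le> n" "b \<le> n" "c \<le> n" using pos by (auto simp: n_def)
  have fin: "finite A" "finite B" "finite C"
    using card by (auto intro: card_ge_0_finite)
  have ne: "A \<noteq> {}" "B \<noteq> {}" "C \<noteq> {}" using card by auto
  have fact_nz: "of_nat (fact k) \<noteq> (0::'a)" if k: "k \<le> n" for k
  proof -
    obtain d :: nat where "fact n = fact k * d" using fact_dvd[OF k] by (rule dvdE)
    then show ?thesis using fact unfolding n_def[symmetric] by auto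
  qed
  obtain u where u: "\<And>i. i < Suc a \<Longrightarrow> (\<Sum>x\<in>A. u x * x ^ i) = (if i = a then 1 else 0)"
    using ex_leading_coeff_weights[OF fin(1) ne(1)] unfolding card by auto
  obtain v where v: "\<And>i. i < Suc b \<Longrightarrow> (\<Sum>x\<in>B. v x * x ^ i) = (if i = b then 1 else 0)"
    using ex_leading_coeff_weights[OF fin(2) ne(2)] unfolding card by auto
  obtain w where w: "\<And>i. i < Suc c \<Longrightarrow> (\<Sum>x\<in>C. w x * x ^ i) = (if i = c then 1 else 0)"
    using ex_leading_coeff_weights[OF fin(3) ne(3)] unfolding card by auto
  \<comment> \<open>On polynomials of total degree at most \<open>a + b + c\<close>,
    \<open>S\<close> reads off the coefficient of \<open>x ^ a * y ^ b * z ^ c\<close>: any other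
    monomial has an exponent below \<open>a\<close>, \<open>b\<close> or \<open>c\<close>
    respectively, and the weights kill it. This does the work of the Nullstellensatz.\<close>
  define S where "S f = (\<Sum>x\<in>A. \<Sum>y\<in>B. \<Sum>z\<in>C. u x * v y * w z * f x y z)"
    for f :: "'a \<Rightarrow> 'a \<Rightarrow> 'a \<Rightarrow> 'a"
  have S_add: "S (\<lambda>x y z. f x y z + g x y z) = S f + S g" for f g
    by (simp add: S_def algebra_simps sum.distrib)
  have S_diff: "S (\<lambda>x y z. f x y z - g x y z) = S f - S g" for f g
    by (simp add: S_def algebra_simps sum_subtractf)
  have S_scale: "S (\<lambda>x y z. k * f x y z) = k * S f" for k f
    by (simp add: S_def sum_distrib_left mult_ac)
  have S_sum: "S (\<lambda>x y z. \<Sum>m\<in>M. f m x y z) = (\<Sum>m\<in>M. S (f m))"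
    if "finite M" for M :: "nat set" and f
    using that
  proof (induction rule: finite_induct)
    case empty
    then show ?case by (simp add: S_def)
  next
    case (insert m M)
    then show ?case by (simp add: S_add)
  qed
  define T where "T i j l m = S (\<lambda>x y z. x ^ i * y ^ j * z ^ l * (x + y + z) ^ m)" for i j l m
  have T_0: "T i j l 0 = (\<Sum>x\<in>A. u x * x ^ i) * (\<Sum>y\<in>B. v y * y ^ j) * (\<Sum>z\<in>C. w z * z ^ l)"
    for i j l
    by (simp only: T_def S_def mult.assoc sum_distrib_right, simp only: sum_distrib_left)
      (simp add: mult_ac)
  have T_Suc: "T i j l (Suc m) = T (Suc i) j l m + T i (Suc j) l m + T i j (Suc l) m" for i j l m
    unfolding T_def S_add[symmetric] by (simp add: algebra_simps)
  have T_low: "T i j l m = 0" if "i + j + l + m < a + b + c" for i j l m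
    using that
  proof (induction m arbitrary: i j l)
    case 0
    then have "i < a \<or> j < b \<or> l < c" by linarith
    then show ?case using u[of i] v[of j] w[of l] unfolding T_0 by auto
  next
    case (Suc m)
    then show ?case unfolding T_Suc by simp
  qed
  \<comment> \<open>Setting \<open>1 / (d - i)!\<close> to \<open>0\<close> for \<open>i > d\<close> makes the recursion for \<open>r d (Suc i)\<close> hold for all \<open>i\<close>.\<close>
  define r where "r d i = (if i \<le> d then inverse (of_nat (fact (d - i))) else (0::'a))" for d i :: nat
  \<comment> \<open>The bound \<open>d \<le> n\<close> makes the factorials up to \<open>d!\<close>
    nonzero in the field, so that \<open>d - i\<close> can be cancelled.\<close>
  have r_Suc: "r d (Suc i) = (of_nat d - of_nat i) * r d i" if "d \<le> n" for d i
  proof (cases "i < d")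
    case True
    then obtain k where k: "d = Suc (i + k)" using less_imp_Suc_add by blast
    have mult: "of_nat (fact (Suc k)) = (of_nat (Suc k) * of_nat (fact k) :: 'a)"
      by (simp only: fact_Suc of_nat_mult of_nat_id)
    have "of_nat (fact (Suc k)) \<noteq> (0::'a)" using that k by (intro fact_nz) auto
    then have "of_nat (Suc k) \<noteq> (0::'a)" unfolding mult by (metis mult_zero_left)
    moreover have "of_nat (fact k) \<noteq> (0::'a)" using that k by (intro fact_nz) auto
    moreover have "d - i = Suc k" "d - Suc i = k" "of_nat d - of_nat i = (of_nat (Suc k) :: 'a)"
      using k by auto
    ultimately show ?thesis
      using True by (simp add: r_def mult del: of_nat_Suc of_nat_fact fact_Suc)
  qed (auto simp: r_def)
  \<comment> \<open>The value is the multinomial coefficient of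
    \<open>x ^ (a - i) * y ^ (b - j) * z ^ (c - l)\<close> in \<open>(x + y + z) ^ m\<close>. In the
    induction step the three factors from \<open>r_Suc\<close> add up to \<open>Suc m\<close>; in
    the base case an exponent that is too small forces another that is too large, where
    \<open>r\<close> is \<open>0\<close>.\<close>
  have T_top: "T i j l m = of_nat (fact m) * (r a i * r b j * r c l)"
    if "i + j + l + m = a + b + c" for i j l m
    using that
  proof (induction m arbitrary: i j l)
    case 0
    then consider "i = a" "j = b" "l = c" | "i < a" | "j < b" | "l < c" by linarith
    then show ?case
    proof cases
      case 1
      then show ?thesis unfolding T_0 using u[of a] v[of b] w[of c] by (simp add: r_def)
    next
      case 2
      then have "j > b \<or> l > c" using 0 by linarith
      then show ?thesis unfolding T_0 using 2 u[of i] by (auto simp: r_def)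
    next
      case 3
      then have "i > a \<or> l > c" using 0 by linarith
      then show ?thesis unfolding T_0 using 3 v[of j] by (auto simp: r_def)
    next
      case 4
      then have "i > a \<or> j > b" using 0 by linarith
      then show ?thesis unfolding T_0 using 4 w[of l] by (auto simp: r_def)
    qed
  next
    case (Suc m)
    have "of_nat (i + j + l + Suc m) = (of_nat (a + b + c) :: 'a)" using Suc.prems by (rule arg_cong)
    then have eq: "of_nat a - of_nat i + (of_nat b - of_nat j) + (of_nat c - of_nat l) =
        (of_nat (Suc m) :: 'a)"
      by (simp only: of_nat_add) (simp add: algebra_simps)
    have "T i j l (Suc m) = of_nat (fact m) * (r a i * r b j * r c l) *
        (of_nat a - of_nat i + (of_nat b - of_nat j) + (of_nat c - of_nat l))"
      unfolding T_Suc using Suc.prems n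
      by (simp add: Suc.IH r_Suc algebra_simps)
    then show ?case unfolding eq by (simp add: algebra_simps)
  qed
  \<comment> \<open>\<open>D m\<close> is \<open>S\<close> applied to
    \<open>(x - y) * (y - z) * (x + y + z) ^ m\<close>, with the first two factors multiplied
    out.\<close>
  define D where "D m = T 1 1 0 m - T 1 0 1 m - T 0 2 0 m + T 0 1 1 m" for m
  have r_2: "r b 2 = (of_nat b - 1) * (of_nat b * r b 0)"
    using r_Suc[OF n(3), of 1] r_Suc[OF n(3), of 0] by (simp add: numeral_2_eq_2)
  have r_1: "r a 1 = of_nat a * r a 0" "r b 1 = of_nat b * r b 0" "r c 1 = of_nat c * r c 0"
    using r_Suc[OF n(2), of 0] r_Suc[OF n(3), of 0] r_Suc[OF n(4), of 0] by simp_all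
  \<comment> \<open>After the common factors are taken out,
    \<open>a*b - a*c - b*(b - 1) + b*c\<close> remains.\<close>
  have "D n = of_nat (fact n) * (r a 0 * r b 0 * r c 0) *
      of_int ((int a - int b) * (int b - int c) + int b)"
    using n(1) by (simp add: D_def T_top r_1 r_2 algebra_simps del: One_nat_def)
  moreover have "r a 0 \<noteq> 0" "r b 0 \<noteq> 0" "r c 0 \<noteq> 0"
    using n fact_nz by (auto simp: r_def simp del: of_nat_fact)
  ultimately have D_n: "D n \<noteq> 0"
    using factor fact by (simp add: n_def del: of_nat_fact of_int_add of_int_mult of_int_diff)
  have D_low: "D m = 0" if "m < n" for m
    unfolding D_def using that n by (simp add: T_low)

  define L where "L = L_set [A, B, C]"
  \<comment> \<open>The monomial pads the degree to exactly \<open>n\<close> when \<open>L\<close>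
    has fewer elements.\<close>
  define q where "q = (\<Prod>e\<in>L. [:- e, 1:]) * monom 1 (n - card L)"
  have finL: "finite L" unfolding L_def by (rule finite_L_set_3[OF fin])
  have "card L \<le> n" using small by (simp add: L_def n_def)
  moreover have "degree (\<Prod>e\<in>L. [:- e, 1:]) = card L"
    by (subst degree_prod_eq_sum_degree) auto
  moreover have "(\<Prod>e\<in>L. [:- e, 1:]) \<noteq> 0" using finL by auto
  ultimately have deg_q: "degree q = n"
    unfolding q_def by (subst degree_mult_eq) (auto simp: degree_monom_eq monom_eq_0_iff)
  have "lead_coeff q = 1"
    unfolding q_def by (simp add: lead_coeff_mult lead_coeff_prod degree_monom_eq)
  then have q_n: "coeff q n = 1" by (simp add: deg_q)
  have q_root: "poly q s = 0" if "s \<in> L" for s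
    using that finL by (auto simp: q_def poly_prod)
  have "0 = S (\<lambda>x y z. (x - y) * (y - z) * poly q (x + y + z))"
  proof -
    have "(x - y) * (y - z) * poly q (x + y + z) = 0" if "x \<in> A" "y \<in> B" "z \<in> C" for x y z
    proof (cases "x = y \<or> y = z")
      case False
      then have "x + y + z \<in> L" using that unfolding L_def L_set_3 by blast
      then show ?thesis by (simp add: q_root)
    qed auto
    then show ?thesis unfolding S_def by (simp del: mult_eq_0_iff)
  qed
  \<comment> \<open>The trivial exponents are written out so that each term has the shape of
    \<open>T\<close>.\<close>
  also have "\<dots> = S (\<lambda>x y z. \<Sum>m\<le>n. coeff q m *
      (x ^ 1 * y ^ 1 * z ^ 0 * (x + y + z) ^ m - x ^ 1 * y ^ 0 * z ^ 1 * (x + y + z) ^ m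
       - x ^ 0 * y ^ 2 * z ^ 0 * (x + y + z) ^ m + x ^ 0 * y ^ 1 * z ^ 1 * (x + y + z) ^ m))"
    by (intro arg_cong[of _ _ S] ext)
      (simp add: poly_altdef deg_q sum_distrib_left algebra_simps power2_eq_square)
  also have "\<dots> = (\<Sum>m\<le>n. coeff q m * D m)"
    by (simp only: S_sum[OF finite_atMost] S_scale S_add S_diff D_def T_def)
  also have "\<dots> = (\<Sum>m\<in>{n}. coeff q m * D m)"
    by (rule sum.mono_neutral_right) (auto simp: D_low)
  finally show False using D_n q_n by simp
qed

section \<open>Bounds over fields\<close>

lemma card_L_set_3_ge_monotone:
  fixes A B C :: "'a::field_char_0 set"
  assumes "2 \<le> card A" "card A \<le> card B" "card B \<le> card C"
  shows "card (L_set [A, B, C]) \<ge> card A + card B + card C - 4"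
proof -
  define a b c where "a = card A - 1" and "b = card B - 1" and "c = card C - 1"
  have card: "card A = Suc a" "card B = Suc b" "card C = Suc c" and pos: "a > 0" "b > 0" "c > 0"
    using assms by (auto simp: a_def b_def c_def)
  have "(int a - int b) * (int b - int c) \<ge> 0"
    using assms card by (intro mult_nonpos_nonpos) auto
  then have "(int a - int b) * (int b - int c) + int b \<noteq> 0" using pos by linarith
  then have "card (L_set [A, B, C]) \<ge> a + b + c - 1"
    by (intro card_L_set_3_ge card pos)
      (simp_all only: of_int_eq_0_iff of_nat_eq_0_iff fact_nonzero not_False_eq_True)
  then show ?thesis using card by simp
qed

lemma card_L_set_3_ge_p_char:
  fixes A B C :: "'a::field set"
  assumes card2: "card A \<ge> 2" "card C \<ge> 2" and AB: "card B = card A \<or> card B = Suc (card A)"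
    and le: "enat (card A + card B + card C - 4) \<le> p_char TYPE('a)"
  shows "card (L_set [A, B, C]) \<ge> card A + card B + card C - 4"
proof -
  define a b c where "a = card A - 1" and "b = card B - 1" and "c = card C - 1"
  have card: "card A = Suc a" "card B = Suc b" "card C = Suc c" and pos: "a > 0" "b > 0" "c > 0"
    using card2 AB by (auto simp: a_def b_def c_def)
  have ab: "b = a \<or> b = Suc a" using AB card by auto
  \<comment> \<open>The upper limit is one less than \<open>card A + card B + card C - 4\<close>,
    hence below a positive characteristic. Both \<open>b\<close> and \<open>c\<close> lie in this
    range.\<close>
  have nz: "of_nat k \<noteq> (0::'a)" if "0 < k" "k \<le> a + b + c - 2" for k
  proof
    assume "of_nat k = (0::'a)"
    then have dvd: "CHAR('a) dvd k" by (simp add: of_nat_eq_0_iff_char_dvd)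
    then have "CHAR('a) > 0" using that by (cases "CHAR('a) = 0") auto
    moreover have "CHAR('a) \<le> k" using dvd that by (intro dvd_imp_le) auto
    ultimately show False using le that pos card by (auto simp: p_char_def)
  qed
  have fact: "of_nat (fact k) \<noteq> (0::'a)" if "k \<le> a + b + c - 2" for k
    using that
  proof (induction k)
    case (Suc k)
    then have "of_nat (Suc k) * of_nat (fact k) \<noteq> (0::'a)" using nz[of "Suc k"] by auto
    then show ?case by (simp only: fact_Suc of_nat_mult of_nat_id not_False_eq_True)
  qed simp
  have factor: "of_int ((int a - int b) * (int b - int c) + int b) \<noteq> (0::'a)"
    using ab
  proof
    assume "b = a"
    then show ?thesis using nz[of b] pos by simp
  next
    assume "b = Suc a"
    then have "(int a - int b) * (int b - int c) + int b = int c" by simp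
    moreover have "of_nat c \<noteq> (0::'a)" using \<open>b = Suc a\<close> pos by (intro nz) auto
    ultimately show ?thesis by (metis of_int_of_nat_eq)
  qed
  have "card (L_set [A, B, C]) \<ge> a + b + c - 1"
    by (intro card_L_set_3_ge card pos fact factor) simp
  then show ?thesis using card by simp
qed

lemma card_L_set_3_ge_min_p_char:
  fixes A B C :: "'a::field set"
  assumes fin: "finite A" "finite B" "finite C"
    and card2: "card A \<ge> 2" "card C \<ge> 2" and AB: "card B = card A \<or> card B = Suc (card A)"
  shows "enat (card (L_set [A, B, C])) \<ge>
    min (p_char TYPE('a)) (enat (card A + card B + card C - 4))"
proof (cases "enat (card A + card B + card C - 4) \<le> p_char TYPE('a)")
  case True
  then show ?thesis using card_L_set_3_ge_p_char[OF card2 AB] by (simp add: min_def)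
next
  case False
  define p where "p = CHAR('a)"
  have p: "p > 0" "p_char TYPE('a) = enat p" "p < card A + card B + card C - 4"
    using False by (auto simp: p_char_def p_def split: if_splits)
  have "prime p" unfolding p_def using p(1) p_def by (intro prime_CHAR_semidom) auto
  then have p2: "p \<ge> 2" by (rule prime_ge_2_nat)
  \<comment> \<open>Sizes of subsets whose bound is exactly \<open>p\<close>. If possible only the
    third set shrinks, keeping at least 2 elements because
    \<open>card A + card B \<le> p + 2\<close>. Otherwise it shrinks to 2 and the remaining
    \<open>p + 2\<close> is split as evenly as possible between the first two.\<close>
  have "\<exists>i j k. i \<le> card A \<and> j \<le> card B \<and> k \<le> card C \<and> 2 \<le> i \<and> 2 \<le> k \<and>
      (j = i \<or> j = Suc i) \<and> i + j + k = p + 4"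
  proof (cases "card A + card B \<le> p + 2")
    case True
    then show ?thesis using p card2 AB
      by (intro exI[of _ "card A"] exI[of _ "card B"] exI[of _ "p + 4 - (card A + card B)"]) auto
  next
    case False
    obtain m where "p = 2 * m \<or> p = Suc (2 * m)" by (metis evenE oddE Suc_eq_plus1)
    then show ?thesis using False p2 card2 AB
      by (intro exI[of _ "Suc m"] exI[of _ "p + 1 - m"] exI[of _ 2]) auto
  qed
  then obtain i j k where ijk: "i \<le> card A" "j \<le> card B" "k \<le> card C" "2 \<le> i" "2 \<le> k"
      "j = i \<or> j = Suc i" "i + j + k = p + 4" by blast
  obtain A' B' C' where sub: "A' \<subseteq> A" "B' \<subseteq> B" "C' \<subseteq> C"
    and card': "card A' = i" "card B' = j" "card C' = k"
    using ijk(1-3) by (meson obtain_subset_with_card_n)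
  have "p \<le> card (L_set [A', B', C'])"
    using card_L_set_3_ge_p_char[of A' C' B'] ijk p card' by simp
  also have "\<dots> \<le> card (L_set [A, B, C])"
    by (intro card_mono finite_L_set_3 fin L_set_3_mono sub)
  finally show ?thesis using p by (simp add: min_def)
qed

section \<open>Abelian groups as modules over the integers\<close>

text \<open>The integer multiple of a group element: \<open>nat\<close> truncates at
  \<open>0\<close>, so at most one of the two sums is nonempty. With it, \<open>zmod.span\<close> is
  the generated subgroup.\<close>

definition zscale :: "int \<Rightarrow> 'g::ab_group_add \<Rightarrow> 'g" where
  "zscale n x = (\<Sum>i<nat n. x) - (\<Sum>i<nat (- n). x)"

lemma sum_const_add: "(\<Sum>i<m + n. x) = (\<Sum>i<m. x) + (\<Sum>i<(n::nat). x :: 'g::ab_group_add)"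
  by (induction n) (simp_all add: add_ac)

text \<open>Allows additivity in the scalar to be checked on arbitrary differences of naturals,
  without cases on signs.\<close>

lemma zscale_diff: "zscale (int m - int n) x = (\<Sum>i<m. x) - (\<Sum>i<n. x)"
proof (cases "m \<le> n")
  case True
  then obtain k where "n = m + k" using le_Suc_ex by blast
  then show ?thesis by (simp add: zscale_def sum_const_add)
next
  case False
  then obtain k where "m = n + k" using le_Suc_ex nat_le_linear by blast
  then show ?thesis by (simp add: zscale_def sum_const_add)
qed

lemma zscale_int: "zscale (int m) x = (\<Sum>i<m. x)"
  by (simp add: zscale_def)

lemma zscale_add_left: "zscale (a + b) x = zscale a x + zscale b x"
proof (cases a rule: int_diff_cases)
  case a: (diff m n)
  show ?thesis
  proof (cases b rule: int_diff_cases)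
    case (diff k l)
    have eq: "a + b = int (m + k) - int (n + l)" using a diff by simp
    show ?thesis by (subst eq) (simp only: a diff zscale_diff sum_const_add, simp)
  qed
qed

lemma zscale_add_right: "zscale a (x + y) = zscale a x + zscale a y"
  by (simp add: zscale_def sum.distrib)

lemma zscale_minus_left: "zscale (- a) x = - zscale a x"
  by (simp add: zscale_def)

lemma zscale_0: "zscale 0 x = 0"
  by (simp add: zscale_def)

lemma zscale_1: "zscale 1 x = x"
  by (simp add: zscale_def)

lemma zscale_mult: "zscale a (zscale b x) = zscale (a * b) x"
proof -
  have nat: "zscale (int m) (zscale b x) = zscale (int m * b) x" for m
    by (induction m) (simp_all add: zscale_0 zscale_1 zscale_add_left algebra_simps)
  show ?thesis
    by (cases a rule: int_cases2) (simp_all add: nat zscale_minus_left)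
qed

interpretation zmod: module zscale
  by unfold_locales
    (simp_all add: zscale_add_right zscale_add_left zscale_mult zscale_1)

lemma torsion_free_zscale:
  assumes "torsion_free TYPE('g::ab_group_add)" "zscale n (x::'g) = 0" "n > 0"
  shows "x = 0"
  using assms zscale_int[of "nat n" x] unfolding torsion_free_def
  by (metis int_nat_eq less_le zero_less_nat_eq)

section \<open>Torsion-free groups and homomorphisms to the rationals\<close>

text \<open>Generators are adjoined one at a time. Either a multiple of the new one lies in the old
  span, or its image can be chosen freely, with finitely many values to avoid.\<close>

lemma torsion_free_ex_hom_rat:
  fixes S D :: "'g::ab_group_add set"
  assumes tf: "torsion_free TYPE('g)" and "finite S" "finite D" "D \<subseteq> zmod.span S" "0 \<notin> D"
  shows "\<exists>f::'g \<Rightarrow> rat. (\<forall>x\<in>zmod.span S. \<forall>y\<in>zmod.span S. f (x + y) = f x + f y) \<and>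
    (\<forall>d\<in>D. f d \<noteq> 0)"
  using assms(2-)
proof (induction S arbitrary: D rule: finite_induct)
  case empty
  then have "D = {}" by auto
  then show ?case by (intro exI[of _ "\<lambda>_. 0"]) simp
next
  case (insert g S)
  let ?H = "zmod.span S" and ?K = "zmod.span (insert g S)"
  have K: "x \<in> ?K \<longleftrightarrow> (\<exists>k. x - zscale k g \<in> ?H)" for x
    by (simp add: zmod.span_insert)
  show ?case
  proof (cases "\<exists>n>0. zscale n g \<in> ?H")
    case True
    then obtain n where n: "n > 0" "zscale n g \<in> ?H" by blast
    \<comment> \<open>Multiplication by \<open>n\<close> maps the new span into the old one and, by
      torsion-freeness, keeps \<open>D\<close> away from \<open>0\<close>; composing with it gives
      the homomorphism.\<close>
    have H: "zscale n x \<in> ?H" if "x \<in> ?K" for x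
    proof -
      from that obtain k where k: "x - zscale k g \<in> ?H" unfolding K by blast
      have "zscale n x = zscale n (x - zscale k g) + zscale k (zscale n g)"
        by (simp add: zmod.scale_right_diff_distrib mult.commute)
      also have "\<dots> \<in> ?H" by (intro zmod.span_add zmod.span_scale[OF k] zmod.span_scale[OF n(2)])
      finally show ?thesis .
    qed
    have zero: "0 \<notin> zscale n ` D"
      using torsion_free_zscale[OF tf _ n(1)] insert.prems by fastforce
    have sub: "zscale n ` D \<subseteq> ?H" using H insert.prems by blast
    obtain f :: "'g \<Rightarrow> rat" where "\<forall>x\<in>?H. \<forall>y\<in>?H. f (x + y) = f x + f y"
      and "\<forall>d\<in>zscale n ` D. f d \<noteq> 0"
      using insert.IH[OF finite_imageI[OF insert.prems(1)] sub zero] by (elim exE conjE)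
    then have f: "\<And>x y. x \<in> ?H \<Longrightarrow> y \<in> ?H \<Longrightarrow> f (x + y) = f x + f y"
      "\<And>d. d \<in> D \<Longrightarrow> f (zscale n d) \<noteq> 0"
      by simp_all
    show ?thesis
      by (rule exI[of _ "\<lambda>x. f (zscale n x)"]) (simp add: f H zmod.scale_right_distrib)
  next
    case False
    have unique: "k = l" if "x - zscale k g \<in> ?H" "x - zscale l g \<in> ?H" for x k l
    proof -
      have "zscale (k - l) g \<in> ?H" "zscale (l - k) g \<in> ?H"
        using zmod.span_diff[OF that(2,1)] zmod.span_diff[OF that]
        by (simp_all add: zmod.scale_left_diff_distrib)
      with False show "k = l" by (metis diff_gt_0_iff_gt linorder_less_linear)
    qed
    \<comment> \<open>The new span is now the direct sum of the old one and the infinite cyclic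
      group of \<open>g\<close>; \<open>k\<close> and \<open>h\<close> are the coordinates.\<close>
    define k where "k x = (THE k. x - zscale k g \<in> ?H)" for x
    have k_eq: "k x = l" if "x - zscale l g \<in> ?H" for x l
      unfolding k_def using that unique by blast
    define h where "h x = x - zscale (k x) g" for x
    have h_H: "h x \<in> ?H" if "x \<in> ?K" for x
      using that k_eq unfolding K h_def by blast
    have k_add: "k (x + y) = k x + k y" if "x \<in> ?K" "y \<in> ?K" for x y
    proof (rule k_eq)
      have "h x + h y \<in> ?H" using that h_H zmod.span_add by blast
      then show "x + y - zscale (k x + k y) g \<in> ?H"
        by (simp add: h_def zmod.scale_left_distrib algebra_simps)
    qed
    have h_add: "h (x + y) = h x + h y" if "x \<in> ?K" "y \<in> ?K" for x y
      using k_add[OF that] by (simp add: h_def zmod.scale_left_distrib)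
    \<comment> \<open>An element of \<open>D\<close> with \<open>h d = 0\<close> is a nonzero
      multiple of \<open>g\<close> and is left to the choice of \<open>t\<close>.\<close>
    have "finite (h ` D - {0})" "h ` D - {0} \<subseteq> ?H" "0 \<notin> h ` D - {0}"
      using insert.prems h_H by auto
    from insert.IH[OF this] obtain f :: "'g \<Rightarrow> rat"
      where "\<forall>x\<in>?H. \<forall>y\<in>?H. f (x + y) = f x + f y" and "\<forall>d\<in>h ` D - {0}. f d \<noteq> 0"
      by (elim exE conjE)
    then have f: "\<And>x y. x \<in> ?H \<Longrightarrow> y \<in> ?H \<Longrightarrow> f (x + y) = f x + f y"
      "\<And>d. d \<in> h ` D - {0} \<Longrightarrow> f d \<noteq> 0"
      by simp_all
    \<comment> \<open>\<open>t\<close> will be the image of \<open>g\<close>. Each \<open>d\<close>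
      with \<open>k d \<noteq> 0\<close> forbids one value; if \<open>k d = 0\<close>, division by
      zero merely forbids \<open>t = 0\<close>, and \<open>f d \<noteq> 0\<close> already
      holds.\<close>
    have "finite ((\<lambda>d. - f (h d) / of_int (k d)) ` D)" using insert.prems by simp
    then obtain t where t: "t \<notin> (\<lambda>d. - f (h d) / of_int (k d)) ` D"
      using ex_new_if_finite[OF infinite_UNIV_char_0] by blast
    have "f (h d) + t * of_int (k d) \<noteq> 0" if "d \<in> D" for d
    proof (cases "k d = 0")
      case True
      then have "h d = d" by (simp add: h_def)
      then have "d \<in> h ` D - {0}" using that insert.prems by force
      then show ?thesis using f(2)[of d] True \<open>h d = d\<close> by simp
    next
      case False
      show ?thesis
      proof
        assume "f (h d) + t * of_int (k d) = 0"
        then have "t = - f (h d) / of_int (k d)" using False by (simp add: field_simps add_eq_0_iff)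
        then show False using t that by blast
      qed
    qed
    then show ?thesis
      by (intro exI[of _ "\<lambda>x. f (h x) + t * of_int (k x)"])
        (simp add: h_add k_add f h_H algebra_simps)
  qed
qed

lemma card_L_set_3_ge_torsion_free:
  fixes A B C :: "'g::ab_group_add set"
  assumes tf: "torsion_free TYPE('g)" and fin: "finite A" "finite B" "finite C"
    and card: "2 \<le> card A" "card A \<le> card B" "card B \<le> card C"
  shows "card (L_set [A, B, C]) \<ge> card A + card B + card C - 4"
proof -
  define U where "U = A \<union> B \<union> C"
  \<comment> \<open>Being nonzero on these differences makes \<open>f\<close> injective on
    \<open>U\<close>.\<close>
  define D where "D = (\<lambda>(x, y). x - y) ` (U \<times> U) - {0}"
  have "finite U" "finite D" using fin by (auto simp: U_def D_def)
  have span: "x \<in> zmod.span U" if "x \<in> U" for x using that by (rule zmod.span_base)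
  have "D \<subseteq> zmod.span U" "0 \<notin> D" by (auto simp: D_def span zmod.span_diff)
  then obtain f :: "'g \<Rightarrow> rat"
    where add: "\<And>x y. x \<in> zmod.span U \<Longrightarrow> y \<in> zmod.span U \<Longrightarrow> f (x + y) = f x + f y"
      and nz: "\<And>d. d \<in> D \<Longrightarrow> f d \<noteq> 0"
    using torsion_free_ex_hom_rat[OF tf \<open>finite U\<close> \<open>finite D\<close>] by blast
  have inj: "inj_on f U"
  proof (rule inj_onI, rule ccontr)
    fix x y assume xy: "x \<in> U" "y \<in> U" "f x = f y" "x \<noteq> y"
    then have "x - y \<in> D" by (force simp: D_def)
    then have "f (x - y) \<noteq> 0" by (rule nz)
    moreover have "f (x - y + y) = f (x - y) + f y"
      using xy by (intro add zmod.span_diff span)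
    ultimately show False using xy by simp
  qed
  \<comment> \<open>Distinct images have distinct preimages, so additivity gives this inclusion;
    injectivity serves to preserve the sizes of the three sets.\<close>
  have "L_set [f ` A, f ` B, f ` C] \<subseteq> f ` L_set [A, B, C]"
  proof
    fix s assume "s \<in> L_set [f ` A, f ` B, f ` C]"
    then obtain x y z where xyz: "x \<in> A" "y \<in> B" "z \<in> C" "f x \<noteq> f y" "f y \<noteq> f z"
      and s: "s = f x + f y + f z"
      unfolding L_set_3 by blast
    then have "x + y + z \<in> L_set [A, B, C]" unfolding L_set_3 by blast
    moreover have U: "x \<in> zmod.span U" "y \<in> zmod.span U" "z \<in> zmod.span U"
      using xyz(1-3) by (simp_all add: span[unfolded U_def] U_def)
    have "s = f (x + y + z)"
      using U by (simp add: s add zmod.span_add)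
    ultimately show "s \<in> f ` L_set [A, B, C]" by blast
  qed
  then have "card (L_set [f ` A, f ` B, f ` C]) \<le> card (L_set [A, B, C])"
    using finite_L_set_3[OF fin] by (metis card_image_le card_mono finite_imageI order_trans)
  moreover have "card (f ` A) = card A" "card (f ` B) = card B" "card (f ` C) = card C"
    using inj by (auto intro!: card_image elim: inj_on_subset simp: U_def)
  ultimately show ?thesis
    using card_L_set_3_ge_monotone[of "f ` A" "f ` B" "f ` C"] card by simp
qed


theorem theorem1p1:
  shows "(\<forall>A1 A2 A3 :: 'a::field set.
            finite A1 \<and> finite A2 \<and> finite A3 \<and>
            card A1 \<ge> 2 \<and> card A3 \<ge> 2 \<and>
            int (card A2) - int (card A1) \<in> {0, 1} \<longrightarrow>
            enat (card (L_set [A1, A2, A3])) \<ge>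
              min (p_char TYPE('a)) (enat (card A1 + card A2 + card A3 - 4))) \<and>
         (torsion_free TYPE('g::ab_group_add) \<longrightarrow>
           (\<forall>A1 A2 A3 :: 'g set.
              finite A1 \<and> finite A2 \<and> finite A3 \<and>
              2 \<le> card A1 \<and> card A1 \<le> card A2 \<and> card A2 \<le> card A3 \<longrightarrow>
              card (L_set [A1, A2, A3]) \<ge> card A1 + card A2 + card A3 - 4))"
proof (intro conjI allI impI)
  fix A1 A2 A3 :: "'a set"
  assume "finite A1 \<and> finite A2 \<and> finite A3 \<and> card A1 \<ge> 2 \<and> card A3 \<ge> 2 \<and>
    int (card A2) - int (card A1) \<in> {0, 1}"
  then show "enat (card (L_set [A1, A2, A3])) \<ge>
      min (p_char TYPE('a)) (enat (card A1 + card A2 + card A3 - 4))"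
    by (intro card_L_set_3_ge_min_p_char) auto
qed (simp add: card_L_set_3_ge_torsion_free)

end
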